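(* Let $A$ be a semilattice of abelian groups and $T$ an inverse semigroup. Then any crossed module extension $A\xrightarrow{i}N\xrightarrow{\beta}S\xrightarrow{\pi}T$ of $A$ by $T$ induces a $T$-module structure on $A$.
   Context: For an inverse semigroup $T$, $E(T)$ is its semilattice of idempotents. A semilattice of groups is an inverse semigroup that is a disjoint union of groups (equivalently, whose idempotents are central); a semilattice of abelian groups is a commutative one. An endomorphism $\varphi$ of a semilattice of groups $A$ is relatively invertible if there are $\bar\varphi\in\operatorname{End}A$ and $e_\varphi\in E(A)$ such that $\bar\varphi(\varphi(a))=e_\varphi a$ and $\varphi(\bar\varphi(a))=\varphi(e_\varphi)a$ for all $a\in A$, $e_\varphi$ is the identity of $\bar\varphi(A)$ and $\varphi(e_\varphi)$ is the identity of $\varphi(A)$; $\operatorname{end}A$ denotes the set of these, an inverse subsemigroup of $\operatorname{End}A$. A homomorphism is idempotent-separating if it is injective on idempotents. A $T$-module structure on a semilattice of abelian groups $A$ is a pair $(\theta,\eta)$, where $\theta:E(T)\to E(A)$ is an isomorphism and $\eta:T\to\operatorname{end}A$, $t\mapsto\eta_t$, is a homomorphism with $\eta_e(a)=\theta(e)a$ and $\eta_t(\theta(e))=\theta(tet^{-1})$ for all $e\in E(T)$, $t\in T$, $a\in A$. For an inverse semigroup $S$, a crossed $S$-module is a semilattice of groups $N$ with a triple $(\alpha,\lambda,\beta)$, where $\alpha:E(S)\to E(N)$ is an isomorphism, $\lambda:S\to\operatorname{end}N$ is a homomorphism and $\beta:N\to S$ is an idempotent-separating homomorphism with $\beta|_{E(N)}=\alpha^{-1}$,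 such that for all $e\in E(S)$, $s\in S$, $n,n'\in N$: $\lambda_e(n)=\alpha(e)n$; $\lambda_s(\alpha(e))=\alpha(ses^{-1})$; $\lambda_{\beta(n)}(n')=nn'n^{-1}$; $\beta(\lambda_s(n))=s\beta(n)s^{-1}$. A crossed module extension of $A$ by $T$ is a sequence $A\xrightarrow{i}N\xrightarrow{\beta}S\xrightarrow{\pi}T$ where $N$ is a crossed $S$-module with structure $(\alpha,\lambda,\beta)$, $i$ is a monomorphism, $\pi$ is an idempotent-separating epimorphism of inverse semigroups, $i(A)=\beta^{-1}(E(S))$ and $\beta(N)=\pi^{-1}(E(T))$. Terminology: the structure that the word "induces" refers to is the pair $\theta=i^{-1}\circ\alpha\circ(\pi|_{E(S)})^{-1}$, $\eta_t=i^{-1}\circ\lambda_s\circ i$ with $s\in S$ such that $\pi(s)=t$. *)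

theory Defs
  imports "HOL-Algebra.Group"
begin

text \<open>
  The \<open>monoid\<close> record of HOL-Algebra carries a unit, so a record without one is
  used for semigroups.  All conditions are relativised to carriers.  Empty carriers are
  not excluded.
\<close>

record 'a sgrp = "'a partial_object" +
  smult :: "['a, 'a] \<Rightarrow> 'a" (infixl \<open>\<cdot>\<index>\<close> 70)

locale inverse_semigroup =
  fixes S :: "'a sgrp" (structure)
  assumes smult_closed: "\<lbrakk>x \<in> carrier S; y \<in> carrier S\<rbrakk> \<Longrightarrow> x \<cdot> y \<in> carrier S"
    and smult_assoc: "\<lbrakk>x \<in> carrier S; y \<in> carrier S; z \<in> carrier S\<rbrakk>
      \<Longrightarrow> (x \<cdot> y) \<cdot> z = x \<cdot> (y \<cdot> z)"
    and ex1_inverse: "x \<in> carrier S \<Longrightarrow> \<exists>!y. y \<in> carrier S \<and> x \<cdot> y \<cdot> x = x \<and> y \<cdot> x \<cdot> y = y"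

definition sinv :: "'a sgrp \<Rightarrow> 'a \<Rightarrow> 'a" where
  "sinv S x = (THE y. y \<in> carrier S \<and> x \<cdot>\<^bsub>S\<^esub> y \<cdot>\<^bsub>S\<^esub> x = x \<and> y \<cdot>\<^bsub>S\<^esub> x \<cdot>\<^bsub>S\<^esub> y = y)"

definition idems :: "'a sgrp \<Rightarrow> 'a set" where
  "idems S = {e \<in> carrier S. e \<cdot>\<^bsub>S\<^esub> e = e}"

definition idem_sgrp :: "'a sgrp \<Rightarrow> 'a sgrp" where
  "idem_sgrp S = \<lparr>carrier = idems S, smult = smult S\<rparr>"

definition shom :: "'a sgrp \<Rightarrow> 'b sgrp \<Rightarrow> ('a \<Rightarrow> 'b) set" where
  "shom S T = {f \<in> carrier S \<rightarrow> carrier T.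
     \<forall>x\<in>carrier S. \<forall>y\<in>carrier S. f (x \<cdot>\<^bsub>S\<^esub> y) = f x \<cdot>\<^bsub>T\<^esub> f y}"

definition smon :: "'a sgrp \<Rightarrow> 'b sgrp \<Rightarrow> ('a \<Rightarrow> 'b) set" where
  "smon S T = {f \<in> shom S T. inj_on f (carrier S)}"

definition sepi :: "'a sgrp \<Rightarrow> 'b sgrp \<Rightarrow> ('a \<Rightarrow> 'b) set" where
  "sepi S T = {f \<in> shom S T. f ` carrier S = carrier T}"

definition siso :: "'a sgrp \<Rightarrow> 'b sgrp \<Rightarrow> ('a \<Rightarrow> 'b) set" where
  "siso S T = {f \<in> shom S T. bij_betw f (carrier S) (carrier T)}"

definition idempotent_separating :: "'a sgrp \<Rightarrow> ('a \<Rightarrow> 'b) \<Rightarrow> bool" where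
  "idempotent_separating S f \<longleftrightarrow> inj_on f (idems S)"

definition semilattice_of_groups :: "'a sgrp \<Rightarrow> bool" where
  "semilattice_of_groups A \<longleftrightarrow> inverse_semigroup A \<and>
     (\<exists>P. \<Union>P = carrier A \<and> pairwise disjnt P \<and>
       (\<forall>G\<in>P. \<exists>e. group \<lparr>carrier = G, mult = smult A, one = e\<rparr>))"

definition semilattice_of_abelian_groups :: "'a sgrp \<Rightarrow> bool" where
  "semilattice_of_abelian_groups A \<longleftrightarrow> semilattice_of_groups A \<and>
     (\<forall>x\<in>carrier A. \<forall>y\<in>carrier A. x \<cdot>\<^bsub>A\<^esub> y = y \<cdot>\<^bsub>A\<^esub> x)"

text \<open>
  Endomorphisms are taken extensional (\<open>undefined\<close> off the carrier), so that
  equality in \<open>End_sgrp A\<close> is equality of maps on \<open>carrier A\<close>.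
  The product \<open>f \<cdot> g\<close> applies \<open>g\<close> first.
\<close>

definition End_sgrp :: "'a sgrp \<Rightarrow> ('a \<Rightarrow> 'a) sgrp" where
  "End_sgrp A = \<lparr>carrier = shom A A \<inter> extensional (carrier A), smult = compose (carrier A)\<rparr>"

definition identity_of :: "'a sgrp \<Rightarrow> 'a \<Rightarrow> 'a set \<Rightarrow> bool" where
  "identity_of A e B \<longleftrightarrow> e \<in> B \<and> (\<forall>b\<in>B. e \<cdot>\<^bsub>A\<^esub> b = b \<and> b \<cdot>\<^bsub>A\<^esub> e = b)"

definition relatively_invertible :: "'a sgrp \<Rightarrow> ('a \<Rightarrow> 'a) \<Rightarrow> bool" where
  "relatively_invertible A f \<longleftrightarrow> (\<exists>g\<in>carrier (End_sgrp A). \<exists>e\<in>idems A.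
     (\<forall>a\<in>carrier A. g (f a) = e \<cdot>\<^bsub>A\<^esub> a \<and> f (g a) = f e \<cdot>\<^bsub>A\<^esub> a) \<and>
     identity_of A e (g ` carrier A) \<and> identity_of A (f e) (f ` carrier A))"

definition rel_end_sgrp :: "'a sgrp \<Rightarrow> ('a \<Rightarrow> 'a) sgrp" where
  "rel_end_sgrp A = \<lparr>carrier = {f \<in> carrier (End_sgrp A). relatively_invertible A f},
     smult = smult (End_sgrp A)\<rparr>"

definition module_structure ::
  "'t sgrp \<Rightarrow> 'a sgrp \<Rightarrow> ('t \<Rightarrow> 'a) \<Rightarrow> ('t \<Rightarrow> 'a \<Rightarrow> 'a) \<Rightarrow> bool" where
  "module_structure T A \<theta> \<eta> \<longleftrightarrow>
     \<theta> \<in> siso (idem_sgrp T) (idem_sgrp A) \<and>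
     \<eta> \<in> shom T (rel_end_sgrp A) \<and>
     (\<forall>e\<in>idems T. \<forall>a\<in>carrier A. \<eta> e a = \<theta> e \<cdot>\<^bsub>A\<^esub> a) \<and>
     (\<forall>t\<in>carrier T. \<forall>e\<in>idems T. \<eta> t (\<theta> e) = \<theta> (t \<cdot>\<^bsub>T\<^esub> e \<cdot>\<^bsub>T\<^esub> sinv T t))"

definition crossed_module ::
  "'s sgrp \<Rightarrow> 'n sgrp \<Rightarrow> ('s \<Rightarrow> 'n) \<Rightarrow> ('s \<Rightarrow> 'n \<Rightarrow> 'n) \<Rightarrow> ('n \<Rightarrow> 's) \<Rightarrow> bool" where
  "crossed_module S N \<alpha> lam \<beta> \<longleftrightarrow>
     inverse_semigroup S \<and> semilattice_of_groups N \<and>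
     \<alpha> \<in> siso (idem_sgrp S) (idem_sgrp N) \<and>
     lam \<in> shom S (rel_end_sgrp N) \<and>
     \<beta> \<in> shom N S \<and> idempotent_separating N \<beta> \<and>
     (\<forall>f\<in>idems N. \<beta> f = inv_into (idems S) \<alpha> f) \<and>
     (\<forall>e\<in>idems S. \<forall>n\<in>carrier N. lam e n = \<alpha> e \<cdot>\<^bsub>N\<^esub> n) \<and>
     (\<forall>s\<in>carrier S. \<forall>e\<in>idems S. lam s (\<alpha> e) = \<alpha> (s \<cdot>\<^bsub>S\<^esub> e \<cdot>\<^bsub>S\<^esub> sinv S s)) \<and>
     (\<forall>n\<in>carrier N. \<forall>n'\<in>carrier N. lam (\<beta> n) n' = n \<cdot>\<^bsub>N\<^esub> n' \<cdot>\<^bsub>N\<^esub> sinv N n) \<and>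
     (\<forall>s\<in>carrier S. \<forall>n\<in>carrier N. \<beta> (lam s n) = s \<cdot>\<^bsub>S\<^esub> \<beta> n \<cdot>\<^bsub>S\<^esub> sinv S s)"

definition crossed_module_extension ::
  "'a sgrp \<Rightarrow> 'n sgrp \<Rightarrow> 's sgrp \<Rightarrow> 't sgrp \<Rightarrow> ('a \<Rightarrow> 'n) \<Rightarrow>
   ('s \<Rightarrow> 'n) \<Rightarrow> ('s \<Rightarrow> 'n \<Rightarrow> 'n) \<Rightarrow> ('n \<Rightarrow> 's) \<Rightarrow> ('s \<Rightarrow> 't) \<Rightarrow> bool" where
  "crossed_module_extension A N S T i \<alpha> lam \<beta> \<pi> \<longleftrightarrow>
     crossed_module S N \<alpha> lam \<beta> \<and>
     i \<in> smon A N \<and>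
     \<pi> \<in> sepi S T \<and> idempotent_separating S \<pi> \<and>
     i ` carrier A = {n \<in> carrier N. \<beta> n \<in> idems S} \<and>
     \<beta> ` carrier N = {s \<in> carrier S. \<pi> s \<in> idems T}"

definition induced_theta ::
  "'a sgrp \<Rightarrow> 's sgrp \<Rightarrow> ('a \<Rightarrow> 'n) \<Rightarrow> ('s \<Rightarrow> 'n) \<Rightarrow> ('s \<Rightarrow> 't) \<Rightarrow> 't \<Rightarrow> 'a" where
  "induced_theta A S i \<alpha> \<pi> = inv_into (carrier A) i \<circ> \<alpha> \<circ> inv_into (idems S) \<pi>"

text \<open>
  The preimage \<open>s\<close> of \<open>t\<close> is picked by choice; that the result does not
  depend on it, and that the inverses are applied only inside the corresponding images,
  has to be stated separately, as \<open>induced_pair_well_defined\<close>.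
\<close>

definition induced_eta ::
  "'a sgrp \<Rightarrow> 's sgrp \<Rightarrow> ('a \<Rightarrow> 'n) \<Rightarrow> ('s \<Rightarrow> 'n \<Rightarrow> 'n) \<Rightarrow> ('s \<Rightarrow> 't) \<Rightarrow> 't \<Rightarrow> 'a \<Rightarrow> 'a" where
  "induced_eta A S i lam \<pi> t =
     restrict (inv_into (carrier A) i \<circ> lam (SOME s. s \<in> carrier S \<and> \<pi> s = t) \<circ> i) (carrier A)"

definition induced_pair_well_defined ::
  "'a sgrp \<Rightarrow> 's sgrp \<Rightarrow> 't sgrp \<Rightarrow> ('a \<Rightarrow> 'n) \<Rightarrow> ('s \<Rightarrow> 'n) \<Rightarrow> ('s \<Rightarrow> 'n \<Rightarrow> 'n) \<Rightarrow>
   ('s \<Rightarrow> 't) \<Rightarrow> bool" where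
  "induced_pair_well_defined A S T i \<alpha> lam \<pi> \<longleftrightarrow>
     bij_betw \<pi> (idems S) (idems T) \<and>
     \<alpha> ` idems S \<subseteq> i ` carrier A \<and>
     (\<forall>s\<in>carrier S. lam s ` i ` carrier A \<subseteq> i ` carrier A) \<and>
     (\<forall>s\<in>carrier S. induced_eta A S i lam \<pi> (\<pi> s) =
        restrict (inv_into (carrier A) i \<circ> lam s \<circ> i) (carrier A))"

end

theory Submission
  imports Defs
begin

text \<open>
  The Peiffer condition \<open>\<lambda>\<^bsub>\<beta>(n)\<^esub>(n') = n n' n\<^sup>-\<^sup>1\<close> forces \<open>i(A) = \<beta>\<^sup>-\<^sup>1(E(S))\<close> to be central
  in \<open>N\<close>.  If \<open>\<pi>(s) = \<pi>(s')\<close>, then \<open>s\<^sup>-\<^sup>1s = s'\<^sup>-\<^sup>1s'\<close> and \<open>s' = \<beta>(m)s\<close> for some \<open>m\<close>, so that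
  \<open>\<lambda>\<^bsub>s'\<^esub>\<close> and \<open>\<lambda>\<^bsub>s\<^esub>\<close> differ by conjugation with \<open>m\<close>, which on \<open>\<lambda>\<^bsub>s\<^esub>(i(A)) \<subseteq> i(A)\<close> is trivial.
  A relative inverse of \<open>\<eta>\<^bsub>t\<^esub>\<close> is \<open>\<eta>\<close> at the inverse of \<open>t\<close>.
\<close>

section \<open>Inverse semigroups\<close>

lemma idems_closed: "e \<in> idems S \<Longrightarrow> e \<in> carrier S"
  and idems_idem: "e \<in> idems S \<Longrightarrow> e \<cdot>\<^bsub>S\<^esub> e = e"
  by (simp_all add: idems_def)

lemma shom_closed: "f \<in> shom S T \<Longrightarrow> x \<in> carrier S \<Longrightarrow> f x \<in> carrier T"
  and shom_mult:
    "f \<in> shom S T \<Longrightarrow> x \<in> carrier S \<Longrightarrow> y \<in> carrier S \<Longrightarrow> f (x \<cdot>\<^bsub>S\<^esub> y) = f x \<cdot>\<^bsub>T\<^esub> f y"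
  by (auto simp: shom_def)

lemma shom_idems: "f \<in> shom S T \<Longrightarrow> e \<in> idems S \<Longrightarrow> f e \<in> idems T"
  using shom_mult[of f S T e e] by (simp add: idems_def shom_closed[of f S T])

context inverse_semigroup
begin

section \<open>Inverses and the semilattice of idempotents\<close>

lemma sinv_props:
  assumes "x \<in> carrier S"
  shows sinv_closed: "sinv S x \<in> carrier S"
    and mult_sinv_mult: "x \<cdot> sinv S x \<cdot> x = x"
    and sinv_mult_sinv: "sinv S x \<cdot> x \<cdot> sinv S x = sinv S x"
  using theI'[OF ex1_inverse[OF assms]] by (simp_all add: sinv_def)

lemma sinv_eqI:
  assumes "x \<in> carrier S" "y \<in> carrier S" "x \<cdot> y \<cdot> x = x" "y \<cdot> x \<cdot> y = y"
  shows "sinv S x = y"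
  unfolding sinv_def using assms by (intro the1_equality ex1_inverse) auto

lemma sinv_idem: "e \<in> idems S \<Longrightarrow> sinv S e = e"
  by (simp add: idems_def sinv_eqI)

lemma sinv_sinv: "x \<in> carrier S \<Longrightarrow> sinv S (sinv S x) = x"
  by (simp add: sinv_eqI sinv_props)

lemma idem_left: "e \<in> idems S \<Longrightarrow> x \<in> carrier S \<Longrightarrow> e \<cdot> (e \<cdot> x) = e \<cdot> x"
  by (simp add: idems_def flip: smult_assoc)

text \<open>If \<open>x\<close> is the inverse of \<open>e f\<close>, then \<open>f x e\<close> is
  an inverse of \<open>e f\<close> as well, hence equal to \<open>x\<close> by uniqueness. But
  \<open>f x e\<close> is idempotent, and an idempotent is its own inverse, so
  \<open>e f = x\<close>.\<close>

lemma idems_mult: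
  assumes e: "e \<in> idems S" and f: "f \<in> idems S"
  shows "e \<cdot> f \<in> idems S"
proof -
  define x where "x = sinv S (e \<cdot> f)"
  note [simp] = idems_closed[OF e] idems_closed[OF f] idems_idem[OF e] idems_idem[OF f]
    idem_left[OF e] idem_left[OF f] smult_closed smult_assoc
  have x[simp]: "x \<in> carrier S" by (simp add: x_def sinv_closed)
  have efx: "e \<cdot> (f \<cdot> (x \<cdot> (e \<cdot> f))) = e \<cdot> f" "x \<cdot> (e \<cdot> (f \<cdot> x)) = x"
    using mult_sinv_mult[of "e \<cdot> f"] sinv_mult_sinv[of "e \<cdot> f"] by (simp_all flip: x_def)
  have absorb: "x \<cdot> (e \<cdot> (f \<cdot> (x \<cdot> e))) = x \<cdot> e"
    using arg_cong[OF efx(2), of "\<lambda>z. z \<cdot> e"] by simp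
  have "x = f \<cdot> (x \<cdot> e)"
    unfolding x_def by (rule sinv_eqI) (use efx absorb in \<open>simp_all flip: x_def\<close>)
  moreover have "f \<cdot> (x \<cdot> e) \<cdot> (f \<cdot> (x \<cdot> e)) = f \<cdot> (x \<cdot> e)"
    using absorb by simp
  ultimately have "x \<in> idems S" by (simp add: idems_def)
  moreover from this have "sinv S x = x" by (rule sinv_idem)
  moreover have "sinv S x = e \<cdot> f" by (simp add: x_def sinv_sinv)
  ultimately show ?thesis by simp
qed

text \<open>Since the products in both orders are idempotent, \<open>f e\<close> is an inverse of
  \<open>e f\<close>; so is \<open>e f\<close> itself, and inverses are unique.\<close>

lemma idems_commute:
  assumes e: "e \<in> idems S" and f: "f \<in> idems S"
  shows "e \<cdot> f = f \<cdot> e"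
proof -
  note [simp] = idems_closed[OF e] idems_closed[OF f] idem_left[OF e] idem_left[OF f]
    smult_closed smult_assoc
  have "sinv S (e \<cdot> f) = f \<cdot> e"
    using idems_idem[OF idems_mult[OF e f]] idems_idem[OF idems_mult[OF f e]]
    by (intro sinv_eqI) simp_all
  moreover have "sinv S (e \<cdot> f) = e \<cdot> f" by (rule sinv_idem[OF idems_mult[OF e f]])
  ultimately show ?thesis by simp
qed

lemma mult_sinv_idems: "x \<in> carrier S \<Longrightarrow> x \<cdot> sinv S x \<in> idems S"
  and sinv_mult_idems: "x \<in> carrier S \<Longrightarrow> sinv S x \<cdot> x \<in> idems S"
  by (simp_all add: idems_def smult_closed sinv_closed mult_sinv_mult sinv_mult_sinv
      flip: smult_assoc)

lemma mult_sinv_mult_right: "x \<in> carrier S \<Longrightarrow> x \<cdot> (sinv S x \<cdot> x) = x"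
  by (simp add: mult_sinv_mult sinv_closed flip: smult_assoc)

lemma mult_sinv_cancel_left:
  "x \<in> carrier S \<Longrightarrow> y \<in> carrier S \<Longrightarrow> x \<cdot> (sinv S x \<cdot> (x \<cdot> y)) = x \<cdot> y"
  by (metis mult_sinv_mult sinv_closed smult_assoc smult_closed)

lemma sinv_mult:
  assumes [simp]: "x \<in> carrier S" "y \<in> carrier S"
  shows "sinv S (x \<cdot> y) = sinv S y \<cdot> sinv S x"
proof (rule sinv_eqI)
  note [simp] = smult_closed sinv_closed
  \<comment> \<open>These two idempotents meet in the middle of both products; swapping them
    separates the factors in \<open>x\<close> from those in \<open>y\<close>.\<close>
  have comm: "y \<cdot> sinv S y \<cdot> (sinv S x \<cdot> x) = sinv S x \<cdot> x \<cdot> (y \<cdot> sinv S y)"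
    by (intro idems_commute mult_sinv_idems sinv_mult_idems) simp_all
  have "x \<cdot> y \<cdot> (sinv S y \<cdot> sinv S x) \<cdot> (x \<cdot> y)
      = x \<cdot> (y \<cdot> sinv S y \<cdot> (sinv S x \<cdot> x)) \<cdot> y" by (simp add: smult_assoc)
  also have "\<dots> = (x \<cdot> sinv S x \<cdot> x) \<cdot> (y \<cdot> sinv S y \<cdot> y)"
    unfolding comm by (simp add: smult_assoc)
  finally show "x \<cdot> y \<cdot> (sinv S y \<cdot> sinv S x) \<cdot> (x \<cdot> y) = x \<cdot> y"
    by (simp add: mult_sinv_mult)
  have "sinv S y \<cdot> sinv S x \<cdot> (x \<cdot> y) \<cdot> (sinv S y \<cdot> sinv S x)
      = sinv S y \<cdot> (sinv S x \<cdot> x \<cdot> (y \<cdot> sinv S y)) \<cdot> sinv S x" by (simp add: smult_assoc)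
  also have "\<dots> = (sinv S y \<cdot> y \<cdot> sinv S y) \<cdot> (sinv S x \<cdot> x \<cdot> sinv S x)"
    unfolding comm[symmetric] by (simp add: smult_assoc)
  finally show "sinv S y \<cdot> sinv S x \<cdot> (x \<cdot> y) \<cdot> (sinv S y \<cdot> sinv S x) = sinv S y \<cdot> sinv S x"
    by (simp add: sinv_mult_sinv)
qed (simp_all add: smult_closed sinv_closed)

lemma conj_idems:
  assumes e: "e \<in> idems S" and x: "x \<in> carrier S"
  shows "x \<cdot> e \<cdot> sinv S x \<in> idems S"
proof -
  note [simp] = x idems_closed[OF e] smult_closed sinv_closed
  have "x \<cdot> e \<cdot> sinv S x \<cdot> (x \<cdot> e \<cdot> sinv S x) = x \<cdot> (e \<cdot> (sinv S x \<cdot> x)) \<cdot> e \<cdot> sinv S x"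
    by (simp add: smult_assoc)
  also have "\<dots> = x \<cdot> sinv S x \<cdot> x \<cdot> (e \<cdot> e) \<cdot> sinv S x"
    unfolding idems_commute[OF e sinv_mult_idems[OF x]] by (simp add: smult_assoc)
  also have "\<dots> = x \<cdot> e \<cdot> sinv S x"
    by (simp add: mult_sinv_mult idems_idem[OF e])
  finally show ?thesis by (simp add: idems_def)
qed

text \<open>Serves to invert both \<open>\<pi>\<close> and \<open>i\<close> on idempotents. The
  inverse map is multiplicative because a product of idempotents of \<open>S\<close> is again
  idempotent, hence the preimage of the product.\<close>

lemma idem_sgrp_siso_inv:
  assumes f: "f \<in> shom S T" and bij: "bij_betw f (idems S) (idems T)"
  shows "inv_into (idems S) f \<in> siso (idem_sgrp T) (idem_sgrp S)"
proof -
  note bij' = bij_betw_inv_into[OF bij]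
  have "inv_into (idems S) f (x \<cdot>\<^bsub>T\<^esub> y) = inv_into (idems S) f x \<cdot> inv_into (idems S) f y"
    if "x \<in> idems T" "y \<in> idems T" for x y
  proof (rule inv_into_f_eq)
    have xy: "inv_into (idems S) f x \<in> idems S" "inv_into (idems S) f y \<in> idems S"
      using bij_betwE[OF bij'] that by auto
    then show "inv_into (idems S) f x \<cdot> inv_into (idems S) f y \<in> idems S"
      by (rule idems_mult)
    show "f (inv_into (idems S) f x \<cdot> inv_into (idems S) f y) = x \<cdot>\<^bsub>T\<^esub> y"
      using that xy by (simp add: shom_mult[OF f] idems_closed bij_betw_inv_into_right[OF bij])
  qed (use bij in \<open>simp add: bij_betw_def\<close>)
  then show ?thesis
    using bij' by (auto simp: siso_def shom_def idem_sgrp_def dest: bij_betwE)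
qed

end

section \<open>Homomorphisms and isomorphisms\<close>

lemma shom_sinv:
  assumes "inverse_semigroup S" "inverse_semigroup T" and f: "f \<in> shom S T"
    and x: "x \<in> carrier S"
  shows "f (sinv S x) = sinv T (f x)"
proof -
  interpret S: inverse_semigroup S by fact
  interpret T: inverse_semigroup T by fact
  show ?thesis
    by (rule T.sinv_eqI[symmetric])
      (use x in \<open>simp_all add: S.sinv_props S.smult_closed shom_closed[OF f]
         flip: shom_mult[OF f]\<close>)
qed

lemma siso_comp:
  assumes "f \<in> siso R S" "g \<in> siso S T"
  shows "g \<circ> f \<in> siso R T"
  using assms by (auto simp: siso_def shom_def Pi_iff intro: bij_betw_trans)

text \<open>Meant for \<open>induced_theta\<close>, which inverts \<open>i\<close> on all of
  \<open>carrier A\<close>: it is compared with a composite of isomorphisms that inverts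
  \<open>i\<close> on idempotents only.\<close>

lemma siso_cong:
  assumes "f \<in> siso R R'" "\<And>x y. x \<in> carrier R \<Longrightarrow> y \<in> carrier R \<Longrightarrow> x \<cdot>\<^bsub>R\<^esub> y \<in> carrier R"
    and "\<And>x. x \<in> carrier R \<Longrightarrow> f x = g x"
  shows "g \<in> siso R R'"
proof -
  have "g x = f x" if "x \<in> carrier R" for x using assms(3)[OF that] by (rule sym)
  moreover from this have "bij_betw g (carrier R) (carrier R') = bij_betw f (carrier R) (carrier R')"
    by (rule bij_betw_cong)
  ultimately show ?thesis
    using assms(1,2) by (simp add: siso_def shom_def Pi_iff)
qed

section \<open>Endomorphisms and relative invertibility\<close>

lemma End_sgrpI:
  assumes "f \<in> shom A A" "f \<in> extensional (carrier A)"
  shows "f \<in> carrier (End_sgrp A)"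
  using assms by (simp add: End_sgrp_def)

text \<open>The witnesses are \<open>\<eta> (t^-1)\<close> and \<open>\<theta> (t^-1 t)\<close>:
  each composite of \<open>\<eta> t\<close> and \<open>\<eta> (t^-1)\<close> is
  \<open>\<eta>\<close> at an idempotent, that is, multiplication by a value of
  \<open>\<theta>\<close>.\<close>

lemma relatively_invertible_action:
  assumes "inverse_semigroup T" and comm: "\<And>e a. e \<in> idems A \<Longrightarrow> a \<in> carrier A \<Longrightarrow> e \<cdot>\<^bsub>A\<^esub> a = a \<cdot>\<^bsub>A\<^esub> e"
    and \<theta>: "\<And>e. e \<in> idems T \<Longrightarrow> \<theta> e \<in> idems A"
    and \<eta>: "\<eta> \<in> shom T (End_sgrp A)"
    and \<eta>\<theta>: "\<And>e a. e \<in> idems T \<Longrightarrow> a \<in> carrier A \<Longrightarrow> \<eta> e a = \<theta> e \<cdot>\<^bsub>A\<^esub> a"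
    and conj: "\<And>t e. t \<in> carrier T \<Longrightarrow> e \<in> idems T \<Longrightarrow> \<eta> t (\<theta> e) = \<theta> (t \<cdot>\<^bsub>T\<^esub> e \<cdot>\<^bsub>T\<^esub> sinv T t)"
    and t: "t \<in> carrier T"
  shows "relatively_invertible A (\<eta> t)"
proof -
  interpret T: inverse_semigroup T by fact
  have closed: "\<eta> s a \<in> carrier A" if "s \<in> carrier T" "a \<in> carrier A" for s a
    using shom_closed[OF \<eta> that(1)] that(2) by (auto simp: End_sgrp_def intro: shom_closed)
  have mult: "\<eta> s (\<eta> s' a) = \<eta> (s \<cdot>\<^bsub>T\<^esub> s') a"
    if "s \<in> carrier T" "s' \<in> carrier T" "a \<in> carrier A" for s s' a
    using shom_mult[OF \<eta> that(1,2)] that(3) by (simp add: End_sgrp_def compose_def)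
  \<comment> \<open>Conjugating \<open>s^-1 s\<close> by \<open>s\<close> gives
    \<open>s s^-1\<close>, so \<open>\<eta> t\<close> sends the witness
    \<open>\<theta> (t^-1 t)\<close> to \<open>\<theta> (t t^-1)\<close>.\<close>
  have \<eta>\<theta>_sinv: "\<eta> s (\<theta> (sinv T s \<cdot>\<^bsub>T\<^esub> s)) = \<theta> (s \<cdot>\<^bsub>T\<^esub> sinv T s)" if "s \<in> carrier T" for s
    using that
    by (simp add: conj T.sinv_mult_idems T.smult_assoc T.sinv_closed T.smult_closed
        T.mult_sinv_cancel_left)
  \<comment> \<open>Multiplication by this element is \<open>\<eta>\<close> at
    \<open>s s^-1\<close>, which fixes \<open>\<eta> s a\<close> because
    \<open>s s^-1 s = s\<close>. It is proved for every \<open>s\<close> since it serves both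
    \<open>t\<close> and \<open>t^-1\<close>.\<close>
  have identity: "identity_of A (\<theta> (s \<cdot>\<^bsub>T\<^esub> sinv T s)) (\<eta> s ` carrier A)"
    if s: "s \<in> carrier T" for s
  proof -
    have "\<theta> (s \<cdot>\<^bsub>T\<^esub> sinv T s) \<in> \<eta> s ` carrier A"
      by (rule image_eqI[where x = "\<theta> (sinv T s \<cdot>\<^bsub>T\<^esub> s)"])
        (use s in \<open>simp_all add: \<eta>\<theta>_sinv idems_closed[OF \<theta>] T.sinv_mult_idems\<close>)
    moreover have "\<theta> (s \<cdot>\<^bsub>T\<^esub> sinv T s) \<cdot>\<^bsub>A\<^esub> \<eta> s a = \<eta> s a" if "a \<in> carrier A" for a
      using s that
      by (simp add: mult T.mult_sinv_idems T.smult_closed T.sinv_closed T.mult_sinv_mult closed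
          flip: \<eta>\<theta>)
    moreover from s have "\<theta> (s \<cdot>\<^bsub>T\<^esub> sinv T s) \<in> idems A" by (simp add: \<theta> T.mult_sinv_idems)
    ultimately show ?thesis
      by (auto simp: identity_of_def closed s simp flip: comm)
  qed
  show ?thesis
    unfolding relatively_invertible_def
  proof (intro bexI conjI ballI)
    show "\<eta> (sinv T t) \<in> carrier (End_sgrp A)" by (simp add: shom_closed[OF \<eta>] T.sinv_closed t)
    show "\<theta> (sinv T t \<cdot>\<^bsub>T\<^esub> t) \<in> idems A" by (simp add: \<theta> T.sinv_mult_idems t)
    show "identity_of A (\<theta> (sinv T t \<cdot>\<^bsub>T\<^esub> t)) (\<eta> (sinv T t) ` carrier A)"
      using identity[of "sinv T t"] by (simp add: t T.sinv_sinv T.sinv_closed)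
    show "identity_of A (\<eta> t (\<theta> (sinv T t \<cdot>\<^bsub>T\<^esub> t))) (\<eta> t ` carrier A)"
      using identity[OF t] by (simp add: \<eta>\<theta>_sinv t)
  qed (simp_all add: mult t T.sinv_closed \<eta>\<theta>_sinv \<eta>\<theta> T.sinv_mult_idems T.mult_sinv_idems)
qed

section \<open>Crossed module extensions\<close>

locale crossed_module_ext =
  fixes A :: "'a sgrp" and N :: "'n sgrp" and S :: "'s sgrp" and T :: "'t sgrp"
    and i :: "'a \<Rightarrow> 'n" and \<alpha> :: "'s \<Rightarrow> 'n" and lam :: "'s \<Rightarrow> 'n \<Rightarrow> 'n"
    and \<beta> :: "'n \<Rightarrow> 's" and \<pi> :: "'s \<Rightarrow> 't"
  assumes A: "semilattice_of_abelian_groups A"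
    and T: "inverse_semigroup T"
    and ext: "crossed_module_extension A N S T i \<alpha> lam \<beta> \<pi>"
begin

section \<open>The data of a crossed module extension\<close>

lemma cm: "crossed_module S N \<alpha> lam \<beta>"
  using ext by (simp add: crossed_module_extension_def)

sublocale A: inverse_semigroup A
  using A by (simp add: semilattice_of_abelian_groups_def semilattice_of_groups_def)

sublocale T: inverse_semigroup T by (rule T)

sublocale S: inverse_semigroup S
  using cm by (simp add: crossed_module_def)

sublocale N: inverse_semigroup N
  using cm by (simp add: crossed_module_def semilattice_of_groups_def)

lemma A_comm: "x \<in> carrier A \<Longrightarrow> y \<in> carrier A \<Longrightarrow> x \<cdot>\<^bsub>A\<^esub> y = y \<cdot>\<^bsub>A\<^esub> x"
  using A by (simp add: semilattice_of_abelian_groups_def)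

lemma i_hom: "i \<in> shom A N" and i_inj: "inj_on i (carrier A)"
  and \<pi>_hom: "\<pi> \<in> shom S T" and \<pi>_surj: "\<pi> ` carrier S = carrier T"
  and \<pi>_inj: "inj_on \<pi> (idems S)"
  and range_i: "i ` carrier A = {n \<in> carrier N. \<beta> n \<in> idems S}"
  and range_\<beta>: "\<beta> ` carrier N = {s \<in> carrier S. \<pi> s \<in> idems T}"
  using ext by (simp_all add: crossed_module_extension_def smon_def sepi_def
      idempotent_separating_def)

lemma \<beta>_hom: "\<beta> \<in> shom N S"
  and \<alpha>_siso: "\<alpha> \<in> siso (idem_sgrp S) (idem_sgrp N)"
  and lam_hom: "lam \<in> shom S (rel_end_sgrp N)"
  and lam_idem: "e \<in> idems S \<Longrightarrow> n \<in> carrier N \<Longrightarrow> lam e n = \<alpha> e \<cdot>\<^bsub>N\<^esub> n"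
  and lam_\<alpha>: "s \<in> carrier S \<Longrightarrow> e \<in> idems S \<Longrightarrow> lam s (\<alpha> e) = \<alpha> (s \<cdot>\<^bsub>S\<^esub> e \<cdot>\<^bsub>S\<^esub> sinv S s)"
  and lam_\<beta>: "n \<in> carrier N \<Longrightarrow> n' \<in> carrier N \<Longrightarrow> lam (\<beta> n) n' = n \<cdot>\<^bsub>N\<^esub> n' \<cdot>\<^bsub>N\<^esub> sinv N n"
  and \<beta>_lam: "s \<in> carrier S \<Longrightarrow> n \<in> carrier N \<Longrightarrow> \<beta> (lam s n) = s \<cdot>\<^bsub>S\<^esub> \<beta> n \<cdot>\<^bsub>S\<^esub> sinv S s"
  using cm by (simp_all add: crossed_module_def)

lemma \<alpha>_bij: "bij_betw \<alpha> (idems S) (idems N)"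
  using \<alpha>_siso by (simp add: siso_def idem_sgrp_def)

lemma \<beta>_\<alpha>: "e \<in> idems S \<Longrightarrow> \<beta> (\<alpha> e) = e"
  and \<alpha>_\<beta>: "f \<in> idems N \<Longrightarrow> \<alpha> (\<beta> f) = f"
  using cm \<alpha>_bij bij_betw_inv_into_left[OF \<alpha>_bij] bij_betw_inv_into_right[OF \<alpha>_bij]
  by (auto simp: crossed_module_def dest: bij_betwE)

lemma lam_closed: "s \<in> carrier S \<Longrightarrow> n \<in> carrier N \<Longrightarrow> lam s n \<in> carrier N"
  and lam_mult_right:
    "s \<in> carrier S \<Longrightarrow> n \<in> carrier N \<Longrightarrow> n' \<in> carrier N \<Longrightarrow>
      lam s (n \<cdot>\<^bsub>N\<^esub> n') = lam s n \<cdot>\<^bsub>N\<^esub> lam s n'"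
  using shom_closed[OF lam_hom, of s] shom_closed[of "lam s" N N n] shom_mult[of "lam s" N N n n']
  by (simp_all add: rel_end_sgrp_def End_sgrp_def)

lemma lam_mult_left:
  "s \<in> carrier S \<Longrightarrow> s' \<in> carrier S \<Longrightarrow> n \<in> carrier N \<Longrightarrow>
    lam (s \<cdot>\<^bsub>S\<^esub> s') n = lam s (lam s' n)"
  by (simp add: shom_mult[OF lam_hom] rel_end_sgrp_def End_sgrp_def compose_def)

section \<open>Lifting along \<open>\<pi>\<close>\<close>

lemma \<pi>_surjE:
  assumes "t \<in> carrier T"
  obtains s where "s \<in> carrier S" "t = \<pi> s"
  using assms that unfolding \<pi>_surj[symmetric] by (rule imageE) blast

text \<open>Idempotents lift: if \<open>s\<close> lies over an idempotent \<open>t\<close>, then the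
  idempotent \<open>s s^-1\<close> lies over \<open>t t^-1 = t\<close>.\<close>

lemma \<pi>_bij: "bij_betw \<pi> (idems S) (idems T)"
proof -
  have "t \<in> \<pi> ` idems S" if t: "t \<in> idems T" for t
  proof -
    obtain s where s: "s \<in> carrier S" "t = \<pi> s"
      using idems_closed[OF t] by (rule \<pi>_surjE)
    then have "\<pi> (s \<cdot>\<^bsub>S\<^esub> sinv S s) = t"
      using t by (simp add: shom_mult[OF \<pi>_hom] S.sinv_closed T.sinv_idem idems_idem
          shom_sinv[OF S.inverse_semigroup_axioms T \<pi>_hom])
    with s show ?thesis by (metis S.mult_sinv_idems image_eqI)
  qed
  then show ?thesis
    using \<pi>_inj shom_idems[OF \<pi>_hom] by (auto simp: bij_betw_def)
qed

lemma \<pi>_idemE: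
  assumes "e \<in> idems T"
  obtains f where "f \<in> idems S" "e = \<pi> f"
  using assms that unfolding bij_betw_imp_surj_on[OF \<pi>_bij, symmetric] by (rule imageE) blast

section \<open>Centrality of \<open>i(A)\<close> in \<open>N\<close>\<close>

lemma idem_central_N:
  assumes f: "f \<in> idems N" and n: "n \<in> carrier N"
  shows "f \<cdot>\<^bsub>N\<^esub> n = n \<cdot>\<^bsub>N\<^esub> f"
proof -
  note [simp] = idems_closed[OF f] N.smult_closed N.sinv_closed
  \<comment> \<open>\<open>lam (\<beta> f)\<close> is read in two ways: as multiplication by
    \<open>\<alpha> (\<beta> f) = f\<close> and as conjugation by \<open>f\<close>, which is its own
    inverse.\<close>
  have absorb: "f \<cdot>\<^bsub>N\<^esub> m = f \<cdot>\<^bsub>N\<^esub> m \<cdot>\<^bsub>N\<^esub> f" if "m \<in> carrier N" for m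
    using lam_\<beta>[of f m] lam_idem[OF shom_idems[OF \<beta>_hom f] that] that f
    by (simp add: \<alpha>_\<beta> N.sinv_idem)
  \<comment> \<open>Applying \<open>absorb\<close> to \<open>n^-1\<close> and inverting yields the
    mirror identity \<open>n f = f n f\<close>.\<close>
  have "sinv N (f \<cdot>\<^bsub>N\<^esub> sinv N n) = sinv N (f \<cdot>\<^bsub>N\<^esub> sinv N n \<cdot>\<^bsub>N\<^esub> f)"
    using n by (simp flip: absorb)
  then have "n \<cdot>\<^bsub>N\<^esub> f = f \<cdot>\<^bsub>N\<^esub> (n \<cdot>\<^bsub>N\<^esub> f)"
    using n f by (simp add: N.sinv_mult N.sinv_idem N.sinv_sinv)
  also have "\<dots> = f \<cdot>\<^bsub>N\<^esub> n"
    using absorb[OF n] n by (simp add: N.smult_assoc)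
  finally show ?thesis by simp
qed

text \<open>As \<open>\<beta> n\<close> is idempotent, \<open>lam (\<beta> n)\<close> is both
  conjugation by \<open>n\<close> and multiplication by \<open>\<alpha> (\<beta> n)\<close>, which
  equals \<open>n n^-1\<close>. By \<open>range_i\<close> the elements concerned are those of
  \<open>i(A)\<close>.\<close>

lemma central_N:
  assumes n: "n \<in> carrier N" and \<beta>n: "\<beta> n \<in> idems S" and m: "m \<in> carrier N"
  shows "n \<cdot>\<^bsub>N\<^esub> m = m \<cdot>\<^bsub>N\<^esub> n"
proof -
  note [simp] = n m N.smult_closed N.sinv_closed
  have "\<beta> (n \<cdot>\<^bsub>N\<^esub> sinv N n) = \<beta> n"
    using \<beta>n by (simp add: shom_mult[OF \<beta>_hom] S.sinv_idem idems_idem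
        shom_sinv[OF N.inverse_semigroup_axioms S.inverse_semigroup_axioms \<beta>_hom])
  then have "\<alpha> (\<beta> n) = n \<cdot>\<^bsub>N\<^esub> sinv N n"
    using \<alpha>_\<beta>[OF N.mult_sinv_idems[OF n]] by simp
  then have conj: "n \<cdot>\<^bsub>N\<^esub> m \<cdot>\<^bsub>N\<^esub> sinv N n = n \<cdot>\<^bsub>N\<^esub> sinv N n \<cdot>\<^bsub>N\<^esub> m"
    using lam_\<beta>[OF n m] lam_idem[OF \<beta>n m] by simp
  \<comment> \<open>Inserting the central idempotent \<open>n^-1 n\<close> and moving it past
    \<open>m\<close> produces the conjugate \<open>n m n^-1\<close>, to which \<open>conj\<close>
    applies.\<close>
  have "n \<cdot>\<^bsub>N\<^esub> m = n \<cdot>\<^bsub>N\<^esub> (sinv N n \<cdot>\<^bsub>N\<^esub> n \<cdot>\<^bsub>N\<^esub> m)"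
    by (simp add: N.mult_sinv_mult flip: N.smult_assoc)
  also have "\<dots> = n \<cdot>\<^bsub>N\<^esub> m \<cdot>\<^bsub>N\<^esub> sinv N n \<cdot>\<^bsub>N\<^esub> n"
    by (subst idem_central_N[OF N.sinv_mult_idems]) (simp_all add: N.smult_assoc)
  also have "\<dots> = m \<cdot>\<^bsub>N\<^esub> (n \<cdot>\<^bsub>N\<^esub> sinv N n) \<cdot>\<^bsub>N\<^esub> n"
    unfolding conj by (simp add: idem_central_N[OF N.mult_sinv_idems])
  also have "\<dots> = m \<cdot>\<^bsub>N\<^esub> n"
    by (simp add: N.smult_assoc N.mult_sinv_mult_right)
  finally show ?thesis .
qed

section \<open>Invariance of \<open>i(A)\<close> and independence of the preimage\<close>

lemma \<alpha>_range: "e \<in> idems S \<Longrightarrow> \<alpha> e \<in> i ` carrier A"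
  using bij_betwE[OF \<alpha>_bij] by (simp add: range_i \<beta>_\<alpha> idems_closed)

text \<open>\<open>\<beta>\<close> sends \<open>lam s n\<close> to a conjugate of the idempotent
  \<open>\<beta> n\<close>, and conjugates of idempotents are idempotent.\<close>

lemma lam_range: "s \<in> carrier S \<Longrightarrow> n \<in> i ` carrier A \<Longrightarrow> lam s n \<in> i ` carrier A"
  by (simp add: range_i lam_closed \<beta>_lam S.conj_idems)

lemma lam_cong:
  assumes s: "s \<in> carrier S" and s': "s' \<in> carrier S" and eq: "\<pi> s = \<pi> s'"
    and n: "n \<in> i ` carrier A"
  shows "lam s' n = lam s n"
proof -
  note [simp] = s s' S.smult_closed S.sinv_closed N.smult_closed N.sinv_closed
  note \<pi>_simps = shom_mult[OF \<pi>_hom] shom_sinv[OF S.inverse_semigroup_axioms T \<pi>_hom]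
  note \<beta>_simps = shom_mult[OF \<beta>_hom]
    shom_sinv[OF N.inverse_semigroup_axioms S.inverse_semigroup_axioms \<beta>_hom]
  \<comment> \<open>Idempotents with the same image under \<open>\<pi>\<close> coincide.\<close>
  have dom: "sinv S s \<cdot>\<^bsub>S\<^esub> s = sinv S s' \<cdot>\<^bsub>S\<^esub> s'"
    by (rule inj_onD[OF \<pi>_inj]) (simp_all add: \<pi>_simps eq S.sinv_mult_idems)
  have ran: "s \<cdot>\<^bsub>S\<^esub> sinv S s = s' \<cdot>\<^bsub>S\<^esub> sinv S s'"
    by (rule inj_onD[OF \<pi>_inj]) (simp_all add: \<pi>_simps eq S.mult_sinv_idems)
  \<comment> \<open>Exactness at \<open>S\<close> makes the discrepancy \<open>s' s^-1\<close> a
    value \<open>\<beta> m\<close>.\<close>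
  have "\<pi> (s' \<cdot>\<^bsub>S\<^esub> sinv S s) \<in> idems T"
    by (simp add: \<pi>_simps eq T.mult_sinv_idems shom_closed[OF \<pi>_hom])
  then have "s' \<cdot>\<^bsub>S\<^esub> sinv S s \<in> \<beta> ` carrier N"
    by (simp add: range_\<beta>)
  then obtain m where m[simp]: "m \<in> carrier N" and \<beta>m: "\<beta> m = s' \<cdot>\<^bsub>S\<^esub> sinv S s"
    by force
  have s'_eq: "s' = \<beta> m \<cdot>\<^bsub>S\<^esub> s"
    by (simp add: \<beta>m S.smult_assoc dom S.mult_sinv_mult_right)
  \<comment> \<open>An idempotent of \<open>N\<close> is recovered from its
    \<open>\<beta>\<close>-value by \<open>\<alpha>\<close>; this identifies
    \<open>m m^-1\<close>.\<close>
  have "\<beta> (m \<cdot>\<^bsub>N\<^esub> sinv N m) = s' \<cdot>\<^bsub>S\<^esub> (sinv S s \<cdot>\<^bsub>S\<^esub> s) \<cdot>\<^bsub>S\<^esub> sinv S s'"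
    by (simp add: \<beta>_simps \<beta>m S.sinv_mult S.sinv_sinv S.smult_assoc)
  also have "\<dots> = s \<cdot>\<^bsub>S\<^esub> sinv S s"
    by (simp add: dom ran S.mult_sinv_mult flip: S.smult_assoc)
  finally have mm: "m \<cdot>\<^bsub>N\<^esub> sinv N m = \<alpha> (s \<cdot>\<^bsub>S\<^esub> sinv S s)"
    using \<alpha>_\<beta>[OF N.mult_sinv_idems[OF m]] by simp
  have nN[simp]: "n \<in> carrier N" using n by (simp add: range_i)
  have ln: "lam s n \<in> carrier N" "\<beta> (lam s n) \<in> idems S"
    using lam_range[OF s n] by (simp_all add: range_i)
  have "lam s' n = lam (\<beta> m) (lam s n)"
    by (subst s'_eq) (simp add: lam_mult_left shom_closed[OF \<beta>_hom])
  also have "\<dots> = m \<cdot>\<^bsub>N\<^esub> (lam s n \<cdot>\<^bsub>N\<^esub> sinv N m)"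
    using ln by (simp add: lam_\<beta> N.smult_assoc)
  \<comment> \<open>\<open>lam s n\<close> is central, so conjugation by \<open>m\<close> reduces to
    multiplication by \<open>m m^-1\<close>. That is the action of \<open>s s^-1\<close>, which
    \<open>lam s\<close> absorbs.\<close>
  also have "\<dots> = m \<cdot>\<^bsub>N\<^esub> sinv N m \<cdot>\<^bsub>N\<^esub> lam s n"
    using ln by (simp add: central_N N.smult_assoc)
  also have "\<dots> = lam (s \<cdot>\<^bsub>S\<^esub> sinv S s) (lam s n)"
    using ln by (simp add: mm lam_idem S.mult_sinv_idems)
  also have "\<dots> = lam s n"
    by (simp add: S.mult_sinv_mult flip: lam_mult_left)
  finally show ?thesis .
qed

section \<open>The induced pair and its well-definedness\<close>

abbreviation "\<theta> \<equiv> induced_theta A S i \<alpha> \<pi>"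
abbreviation "\<eta> \<equiv> induced_eta A S i lam \<pi>"

text \<open>Frees \<open>\<eta>\<close> from the chosen preimage. Later identities about
  \<open>\<eta>\<close> are checked in \<open>N\<close> after applying the injective
  \<open>i\<close>.\<close>

lemma i_\<eta>:
  assumes s: "s \<in> carrier S" and a: "a \<in> carrier A"
  shows "i (\<eta> (\<pi> s) a) = lam s (i a)"
proof -
  \<comment> \<open>This is the choice made inside \<open>induced_eta\<close>;
    \<open>lam_cong\<close> then trades it for \<open>s\<close>.\<close>
  define s' where "s' = (SOME s'. s' \<in> carrier S \<and> \<pi> s' = \<pi> s)"
  have s': "s' \<in> carrier S" "\<pi> s' = \<pi> s"
    unfolding s'_def using someI_ex[of "\<lambda>s'. s' \<in> carrier S \<and> \<pi> s' = \<pi> s"] s by auto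
  have "i (\<eta> (\<pi> s) a) = lam s' (i a)"
    using a lam_range[OF s'(1)] by (simp add: induced_eta_def f_inv_into_f flip: s'_def)
  also have "\<dots> = lam s (i a)"
    using lam_cong[OF s s'(1) s'(2)[symmetric]] a by simp
  finally show ?thesis .
qed

lemma \<eta>_closed:
  assumes t: "t \<in> carrier T" and a: "a \<in> carrier A"
  shows "\<eta> t a \<in> carrier A"
proof -
  define s where "s = (SOME s. s \<in> carrier S \<and> \<pi> s = t)"
  have "s \<in> carrier S"
    unfolding s_def using someI_ex[of "\<lambda>s. s \<in> carrier S \<and> \<pi> s = t"] \<pi>_surjE[OF t] by metis
  then show ?thesis
    using a by (simp add: induced_eta_def inv_into_into lam_range flip: s_def)
qed

lemma \<eta>_\<pi>:
  assumes s: "s \<in> carrier S"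
  shows "\<eta> (\<pi> s) = restrict (inv_into (carrier A) i \<circ> lam s \<circ> i) (carrier A)"
proof (rule extensionalityI[where A = "carrier A"])
  fix a assume a: "a \<in> carrier A"
  then show "\<eta> (\<pi> s) a = restrict (inv_into (carrier A) i \<circ> lam s \<circ> i) (carrier A) a"
    using s by (simp add: inv_into_f_f[OF i_inj] \<eta>_closed shom_closed[OF \<pi>_hom]
        flip: i_\<eta>)
qed (simp_all add: induced_eta_def)

lemma well_defined: "induced_pair_well_defined A S T i \<alpha> lam \<pi>"
  using \<alpha>_range lam_range \<eta>_\<pi> \<pi>_bij by (auto simp: induced_pair_well_defined_def)

section \<open>The isomorphism \<open>\<theta>\<close> of idempotent semilattices\<close>

lemma i_\<theta>:
  assumes e: "e \<in> idems S"
  shows "i (\<theta> (\<pi> e)) = \<alpha> e"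
  using e by (simp add: induced_theta_def bij_betw_inv_into_left[OF \<pi>_bij] \<alpha>_range f_inv_into_f)

text \<open>An idempotent of \<open>N\<close> has an idempotent image under \<open>\<beta>\<close>,
  so it lies in \<open>i(A)\<close>; injectivity of \<open>i\<close> makes its preimage
  idempotent.\<close>

lemma i_bij: "bij_betw i (idems A) (idems N)"
proof -
  have "n \<in> i ` idems A" if n: "n \<in> idems N" for n
  proof -
    have "n \<in> i ` carrier A"
      using n shom_idems[OF \<beta>_hom n] by (simp add: range_i idems_closed)
    then obtain a where a: "a \<in> carrier A" "n = i a" by blast
    have "a \<cdot>\<^bsub>A\<^esub> a = a"
      by (rule inj_onD[OF i_inj])
        (use a n in \<open>simp_all add: shom_mult[OF i_hom] idems_idem A.smult_closed\<close>)
    with a show ?thesis by (simp add: idems_def)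
  qed
  then show ?thesis
    using inj_on_subset[OF i_inj, of "idems A"] shom_idems[OF i_hom]
    by (auto simp: bij_betw_def subset_iff idems_closed)
qed

lemma \<theta>_siso: "\<theta> \<in> siso (idem_sgrp T) (idem_sgrp A)"
proof (rule siso_cong)
  \<comment> \<open>The composite defining \<open>induced_theta\<close>, but with \<open>i\<close>
    inverted on \<open>idems A\<close>, so that every factor is an isomorphism of
    semilattices.\<close>
  let ?\<theta> = "inv_into (idems A) i \<circ> (\<alpha> \<circ> inv_into (idems S) \<pi>)"
  show "?\<theta> \<in> siso (idem_sgrp T) (idem_sgrp A)"
    by (intro siso_comp[OF siso_comp[OF S.idem_sgrp_siso_inv[OF \<pi>_hom \<pi>_bij] \<alpha>_siso]]
        A.idem_sgrp_siso_inv[OF i_hom i_bij])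
  show "?\<theta> t = \<theta> t" if "t \<in> carrier (idem_sgrp T)" for t
  proof -
    have "\<alpha> (inv_into (idems S) \<pi> t) \<in> idems N"
      using that bij_betwE[OF \<alpha>_bij] bij_betwE[OF bij_betw_inv_into[OF \<pi>_bij]]
      by (simp add: idem_sgrp_def)
    then have "\<alpha> (inv_into (idems S) \<pi> t) \<in> i ` idems A"
      using i_bij by (simp add: bij_betw_def)
    then show ?thesis
      by (auto simp: induced_theta_def i_inj idems_closed
          inv_into_f_f[OF inj_on_subset[OF i_inj]] subset_iff)
  qed
qed (simp add: idem_sgrp_def T.idems_mult)

lemma \<theta>_idems: "e \<in> idems T \<Longrightarrow> \<theta> e \<in> idems A"
  using \<theta>_siso by (auto simp: siso_def shom_def idem_sgrp_def)

section \<open>The action \<open>\<eta>\<close> of \<open>T\<close> on \<open>A\<close>\<close>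

lemma \<eta>_hom: "\<eta> \<in> shom T (End_sgrp A)"
proof -
  have "\<eta> t \<in> carrier (End_sgrp A)" if t: "t \<in> carrier T" for t
  proof (rule End_sgrpI)
    obtain s where s: "s \<in> carrier S" "t = \<pi> s" using t by (rule \<pi>_surjE)
    have "\<eta> t (a \<cdot>\<^bsub>A\<^esub> b) = \<eta> t a \<cdot>\<^bsub>A\<^esub> \<eta> t b" if "a \<in> carrier A" "b \<in> carrier A" for a b
      by (rule inj_onD[OF i_inj])
        (use s t that in \<open>simp_all add: i_\<eta> \<eta>_closed A.smult_closed shom_mult[OF i_hom]
           shom_closed[OF i_hom] shom_closed[OF \<pi>_hom] lam_mult_right\<close>)
    then show "\<eta> t \<in> shom A A" using \<eta>_closed[OF t] by (simp add: shom_def)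
  qed (simp add: induced_eta_def)
  moreover have "\<eta> (t \<cdot>\<^bsub>T\<^esub> t') = compose (carrier A) (\<eta> t) (\<eta> t')"
    if t: "t \<in> carrier T" "t' \<in> carrier T" for t t'
  \<comment> \<open>Both sides are extensional, so agreement on \<open>carrier A\<close> suffices;
    there \<open>i\<close> reduces the claim to \<open>lam_mult_left\<close>.\<close>
  proof (rule extensionalityI[where A = "carrier A"])
    obtain s s' where s: "s \<in> carrier S" "t = \<pi> s" "s' \<in> carrier S" "t' = \<pi> s'"
      using t by (metis \<pi>_surjE)
    fix a assume a: "a \<in> carrier A"
    have "i (\<eta> (t \<cdot>\<^bsub>T\<^esub> t') a) = i (\<eta> t (\<eta> t' a))"
      using s a t by (simp add: i_\<eta> \<eta>_closed lam_mult_left S.smult_closed shom_closed[OF i_hom]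
          shom_closed[OF \<pi>_hom] flip: shom_mult[OF \<pi>_hom])
    then have "\<eta> (t \<cdot>\<^bsub>T\<^esub> t') a = \<eta> t (\<eta> t' a)"
      by (rule inj_onD[OF i_inj]) (simp_all add: \<eta>_closed t a T.smult_closed)
    then show "\<eta> (t \<cdot>\<^bsub>T\<^esub> t') a = compose (carrier A) (\<eta> t) (\<eta> t') a"
      using a by (simp add: compose_def)
  qed (simp_all add: induced_eta_def)
  ultimately show ?thesis by (simp add: shom_def) (simp add: End_sgrp_def)
qed

lemma \<eta>_idem:
  assumes e: "e \<in> idems T" and a: "a \<in> carrier A"
  shows "\<eta> e a = \<theta> e \<cdot>\<^bsub>A\<^esub> a"
proof -
  obtain f where f: "f \<in> idems S" "e = \<pi> f" using e by (rule \<pi>_idemE)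
  have \<theta>e: "\<theta> e \<in> carrier A" using \<theta>_idems[OF e] by (rule idems_closed)
  \<comment> \<open>Over the idempotent lift \<open>f\<close> of \<open>e\<close>,
    \<open>lam f\<close> is multiplication by \<open>\<alpha> f = i (\<theta> e)\<close>.\<close>
  have "i (\<eta> e a) = i (\<theta> e \<cdot>\<^bsub>A\<^esub> a)"
    using f a \<theta>e by (simp add: i_\<eta> i_\<theta> idems_closed lam_idem shom_mult[OF i_hom]
        shom_closed[OF i_hom])
  then show ?thesis
    by (rule inj_onD[OF i_inj]) (simp_all add: \<eta>_closed idems_closed[OF e] a A.smult_closed \<theta>e)
qed

lemma \<eta>_\<theta>:
  assumes t: "t \<in> carrier T" and e: "e \<in> idems T"
  shows "\<eta> t (\<theta> e) = \<theta> (t \<cdot>\<^bsub>T\<^esub> e \<cdot>\<^bsub>T\<^esub> sinv T t)"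
proof -
  obtain f where f: "f \<in> idems S" "e = \<pi> f" using e by (rule \<pi>_idemE)
  obtain s where s: "s \<in> carrier S" "t = \<pi> s" using t by (rule \<pi>_surjE)
  \<comment> \<open>Conjugation commutes with \<open>\<pi>\<close>, and the lift
    \<open>s f s^-1\<close> is idempotent, as \<open>i_\<theta>\<close> requires.\<close>
  have conj: "t \<cdot>\<^bsub>T\<^esub> e \<cdot>\<^bsub>T\<^esub> sinv T t = \<pi> (s \<cdot>\<^bsub>S\<^esub> f \<cdot>\<^bsub>S\<^esub> sinv S s)"
    using f s by (simp add: shom_mult[OF \<pi>_hom] idems_closed S.smult_closed S.sinv_closed
        shom_sinv[OF S.inverse_semigroup_axioms T \<pi>_hom])
  have \<theta>e: "\<theta> e \<in> carrier A" using \<theta>_idems[OF e] by (rule idems_closed)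
  have "i (\<eta> t (\<theta> e)) = i (\<theta> (t \<cdot>\<^bsub>T\<^esub> e \<cdot>\<^bsub>T\<^esub> sinv T t))"
    unfolding conj using f s \<theta>e by (simp add: i_\<eta> i_\<theta> S.conj_idems lam_\<alpha>)
  then show ?thesis
    by (rule inj_onD[OF i_inj])
      (simp_all add: \<eta>_closed t \<theta>e idems_closed[OF \<theta>_idems] T.conj_idems e)
qed

lemma induced_module_structure: "module_structure T A \<theta> \<eta>"
proof -
  \<comment> \<open>\<open>\<eta>_hom\<close> only lands in \<open>End_sgrp A\<close>; relative
    invertibility of each \<open>\<eta> t\<close> moves the codomain to
    \<open>rel_end_sgrp A\<close>.\<close>
  have "relatively_invertible A (\<eta> t)" if "t \<in> carrier T" for t
    using that
    by (intro relatively_invertible_action[OF T _ \<theta>_idems \<eta>_hom \<eta>_idem \<eta>_\<theta>])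
      (simp_all add: A_comm idems_closed)
  then have "\<eta> \<in> shom T (rel_end_sgrp A)"
    using \<eta>_hom by (auto simp: shom_def rel_end_sgrp_def)
  then show ?thesis
    by (simp add: module_structure_def \<theta>_siso \<eta>_idem \<eta>_\<theta>)
qed

end

theorem lemma2p10:
  fixes A :: "'a sgrp" and N :: "'n sgrp" and S :: "'s sgrp" and T :: "'t sgrp"
    and i :: "'a \<Rightarrow> 'n" and \<alpha> :: "'s \<Rightarrow> 'n" and lam :: "'s \<Rightarrow> 'n \<Rightarrow> 'n"
    and \<beta> :: "'n \<Rightarrow> 's" and \<pi> :: "'s \<Rightarrow> 't"
  assumes "semilattice_of_abelian_groups A"
    and "inverse_semigroup T"
    and "crossed_module_extension A N S T i \<alpha> lam \<beta> \<pi>"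
  shows "induced_pair_well_defined A S T i \<alpha> lam \<pi> \<and>
    module_structure T A (induced_theta A S i \<alpha> \<pi>) (induced_eta A S i lam \<pi>)"
proof -
  interpret crossed_module_ext A N S T i \<alpha> lam \<beta> \<pi>
    using assms by (rule crossed_module_ext.intro)
  show ?thesis using well_defined induced_module_structure ..
qed

end
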